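(* Let $(X,d)$ be a semimetric space such that, for some real constant $c>0$, the semimetric $d$ is equivalent to a complete $c$-relaxed metric on $X$ or to a complete $c$-inframetric on $X$. Let $\varphi\colon\mathbb{R}_+\to\mathbb{R}_+$ be a comparison function. Then every $\varphi$-contraction $T\colon X\to X$ (with respect to $d$) has a unique fixed point.
   Context: $\mathbb{R}_+=[0,\infty)$ and $\overline{\mathbb{R}}_+=[0,\infty]$. A semimetric on a nonempty set $X$ is a symmetric function $d\colon X\times X\to\mathbb{R}_+$ with $d(x,y)=0$ if and only if $x=y$ (no triangle inequality is assumed); $(X,d)$ is then a semimetric space. A $c$-relaxed metric on $X$ is a semimetric $\rho$ with $\rho(x,y)\le c\,(\rho(x,z)+\rho(y,z))$ for all $x,y,z\in X$; a $c$-inframetric is a semimetric $\rho$ with $\rho(x,y)\le c\max\{\rho(x,z),\rho(y,z)\}$ for all $x,y,z\in X$. A sequence $(x_n)$ converges to $x$ with respect to a semimetric $\rho$ if $\rho(x_n,x)\to 0$; it is Cauchy if for every $\varepsilon>0$ there is $N$ such that $\rho(x_n,x_m)<\varepsilon$ for all $n,m\ge N$. A semimetric is complete if every Cauchy sequence converges to some point of $X$. For semimetrics $d_1,d_2$ on $X$ define $L_{d_1,d_2}\colon\overline{\mathbb{R}}_+\to\overline{\mathbb{R}}_+$ by $L_{d_1,d_2}(t):=\sup\{d_1(x,y)\mid x,y\in X,\ d_2(x,y)\le t\}$. The semimetrics $d_1$ and $d_2$ are equivalent if $\lim_{t\to 0+}L_{d_1,d_2}(t)=0$ and $\lim_{t\to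 0+}L_{d_2,d_1}(t)=0$. A comparison function is a monotone increasing (i.e. nondecreasing) function $\varphi\colon\mathbb{R}_+\to\mathbb{R}_+$ such that $\lim_{n\to\infty}\varphi^n(t)=0$ for all $t\ge 0$, where $\varphi^n$ is the $n$-th iterate. Given a comparison function $\varphi$, a mapping $T\colon X\to X$ is a $\varphi$-contraction if $d(Tx,Ty)\le\varphi(d(x,y))$ for all $x,y\in X$. *)

theory Defs
  imports "HOL-Analysis.Analysis"
begin

text \<open>
  The space is a carrier set \<open>X\<close>; functions on \<open>X\<close> are total HOL functions that are only
  constrained on \<open>X\<close>.
\<close>

definition semimetric_on :: "'a set \<Rightarrow> ('a \<Rightarrow> 'a \<Rightarrow> real) \<Rightarrow> bool" where
  "semimetric_on X d \<longleftrightarrow> X \<noteq> {} \<and>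
     (\<forall>x\<in>X. \<forall>y\<in>X. 0 \<le> d x y \<and> d x y = d y x \<and> (d x y = 0 \<longleftrightarrow> x = y))"

definition relaxed_metric_on :: "real \<Rightarrow> 'a set \<Rightarrow> ('a \<Rightarrow> 'a \<Rightarrow> real) \<Rightarrow> bool" where
  "relaxed_metric_on c X \<rho> \<longleftrightarrow> semimetric_on X \<rho> \<and>
     (\<forall>x\<in>X. \<forall>y\<in>X. \<forall>z\<in>X. \<rho> x y \<le> c * (\<rho> x z + \<rho> y z))"

definition inframetric_on :: "real \<Rightarrow> 'a set \<Rightarrow> ('a \<Rightarrow> 'a \<Rightarrow> real) \<Rightarrow> bool" where
  "inframetric_on c X \<rho> \<longleftrightarrow> semimetric_on X \<rho> \<and>
     (\<forall>x\<in>X. \<forall>y\<in>X. \<forall>z\<in>X. \<rho> x y \<le> c * max (\<rho> x z) (\<rho> y z))"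

definition semimetric_converges :: "('a \<Rightarrow> 'a \<Rightarrow> real) \<Rightarrow> (nat \<Rightarrow> 'a) \<Rightarrow> 'a \<Rightarrow> bool" where
  "semimetric_converges \<rho> s x \<longleftrightarrow> (\<lambda>n. \<rho> (s n) x) \<longlonglongrightarrow> 0"

definition semimetric_Cauchy :: "('a \<Rightarrow> 'a \<Rightarrow> real) \<Rightarrow> (nat \<Rightarrow> 'a) \<Rightarrow> bool" where
  "semimetric_Cauchy \<rho> s \<longleftrightarrow> (\<forall>\<epsilon>>0. \<exists>N. \<forall>n\<ge>N. \<forall>m\<ge>N. \<rho> (s n) (s m) < \<epsilon>)"

definition semimetric_complete_on :: "'a set \<Rightarrow> ('a \<Rightarrow> 'a \<Rightarrow> real) \<Rightarrow> bool" where
  "semimetric_complete_on X \<rho> \<longleftrightarrow>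
     (\<forall>s. range s \<subseteq> X \<longrightarrow> semimetric_Cauchy \<rho> s \<longrightarrow> (\<exists>x\<in>X. semimetric_converges \<rho> s x))"

text \<open>
  \<open>ennreal\<close> is the type of extended nonnegative reals. The coercion \<open>ennreal\<close> truncates negative
  reals to \<open>0\<close>, which is harmless for semimetrics, as they are nonnegative on \<open>X\<close>.
\<close>

definition semimetric_L ::
    "'a set \<Rightarrow> ('a \<Rightarrow> 'a \<Rightarrow> real) \<Rightarrow> ('a \<Rightarrow> 'a \<Rightarrow> real) \<Rightarrow> ennreal \<Rightarrow> ennreal" where
  "semimetric_L X d1 d2 t =
     Sup {ennreal (d1 x y) | x y. x \<in> X \<and> y \<in> X \<and> ennreal (d2 x y) \<le> t}"

definition semimetric_equivalent_on ::
    "'a set \<Rightarrow> ('a \<Rightarrow> 'a \<Rightarrow> real) \<Rightarrow> ('a \<Rightarrow> 'a \<Rightarrow> real) \<Rightarrow> bool" where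
  "semimetric_equivalent_on X d1 d2 \<longleftrightarrow>
     (semimetric_L X d1 d2 \<longlongrightarrow> 0) (at_right 0) \<and>
     (semimetric_L X d2 d1 \<longlongrightarrow> 0) (at_right 0)"

definition comparison_function :: "(real \<Rightarrow> real) \<Rightarrow> bool" where
  "comparison_function \<phi> \<longleftrightarrow> \<phi> \<in> {0..} \<rightarrow> {0..} \<and> mono_on {0..} \<phi> \<and>
     (\<forall>t\<ge>0. (\<lambda>n. (\<phi> ^^ n) t) \<longlonglongrightarrow> 0)"

definition contraction_on ::
    "(real \<Rightarrow> real) \<Rightarrow> 'a set \<Rightarrow> ('a \<Rightarrow> 'a \<Rightarrow> real) \<Rightarrow> ('a \<Rightarrow> 'a) \<Rightarrow> bool" where
  "contraction_on \<phi> X d T \<longleftrightarrow> T \<in> X \<rightarrow> X \<and> (\<forall>x\<in>X. \<forall>y\<in>X. d (T x) (T y) \<le> \<phi> (d x y))"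

end

theory Submission
  imports Defs
begin

text \<open>
  The theorem is the extension of Matkowski's fixed point theorem to semimetrics without a triangle
  inequality. Two properties of \<open>d\<close> are inherited from the complete
  relaxed metric or inframetric \<open>\<rho>\<close>, because equivalence says that smallness of one semimetric
  forces smallness of the other, uniformly in the points. The first is completeness
  (\<open>complete_transfer\<close>). The second is a weak form of the triangle inequality
  (\<open>regular_if_equivalent_inframetric\<close>): two points that are both close to a third are close to
  each other.

  For such a \<open>d\<close>, the orbit \<open>x\<^sub>n = T\<^sup>n x\<^sub>0\<close> is Cauchy (\<open>orbit_Cauchy\<close>). Bounding distances
  along the orbit by chaining its steps does not work, since the weak triangle inequality loses
  precision each time it is applied and gives no bound along long chains. Instead one
  chooses \<open>m\<close> so large that \<open>T\<^sup>m\<close> shrinks the radius \<open>\<epsilon>\<close> to something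
  tiny. For large \<open>n\<close> the centre \<open>x\<^sub>n\<close> hardly moves under \<open>T\<^sup>m\<close>, so one application of the
  weak triangle inequality shows that \<open>T\<^sup>m\<close> maps the \<open>\<epsilon>\<close>-ball around \<open>x\<^sub>n\<close> into itself. The ball
  contains \<open>x\<^sub>n, \<dots>, x\<^sub>n\<^sub>+\<^sub>m\<^sub>-\<^sub>1\<close>, hence the whole tail of the orbit. The limit of the orbit is a
  fixed point, as \<open>T\<close> does not increase distances, and it is the only one, as \<open>\<phi> t < t\<close> for
  \<open>t > 0\<close>.
\<close>

section \<open>Transfer along equivalence of semimetrics\<close>

lemma semimetric_L_tendsto_0_imp_uniform:
  assumes "(semimetric_L X d1 d2 \<longlongrightarrow> 0) (at_right 0)" and "0 < \<epsilon>"
  shows "\<exists>\<delta>>0. \<forall>x\<in>X. \<forall>y\<in>X. d2 x y \<le> \<delta> \<longrightarrow> d1 x y \<le> \<epsilon>"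
proof -
  have "eventually (\<lambda>t. semimetric_L X d1 d2 t < ennreal \<epsilon>) (at_right 0)"
    using order_tendstoD(2)[OF assms(1)] \<open>0 < \<epsilon>\<close> by simp
  then obtain b :: ennreal where b: "b > 0" "\<And>t. 0 < t \<Longrightarrow> t < b \<Longrightarrow> semimetric_L X d1 d2 t < ennreal \<epsilon>"
    using eventually_at_right[of "0::ennreal" 1] by auto
  obtain t where t: "0 < t" "t < b"
    using dense[OF b(1)] by blast
  then obtain \<delta> where \<delta>: "t = ennreal \<delta>" "0 < \<delta>"
    by (cases t) auto
  have "d1 x y \<le> \<epsilon>" if "x \<in> X" "y \<in> X" "d2 x y \<le> \<delta>" for x y
  proof -
    have "ennreal (d1 x y) \<le> semimetric_L X d1 d2 t"
      unfolding semimetric_L_def \<delta>(1) using that by (intro Sup_upper) (auto intro: ennreal_leI)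
    then have "ennreal (d1 x y) < ennreal \<epsilon>"
      using b(2)[OF t] by (rule le_less_trans)
    then show ?thesis
      by (meson ennreal_leI linorder_le_cases not_le)
  qed
  then show ?thesis
    using \<delta>(2) by blast
qed

lemma complete_transfer:
  assumes complete: "semimetric_complete_on X \<rho>"
    and d: "semimetric_on X d"
    and eq: "semimetric_equivalent_on X d \<rho>"
  shows "semimetric_complete_on X d"
  unfolding semimetric_complete_on_def
proof (intro allI impI)
  fix s :: "nat \<Rightarrow> 'a"
  assume s: "range s \<subseteq> X" and Cauchy: "semimetric_Cauchy d s"
  have "semimetric_Cauchy \<rho> s"
    unfolding semimetric_Cauchy_def
  proof (intro allI impI)
    fix \<epsilon> :: real
    assume "0 < \<epsilon>"
    then obtain \<delta> where \<delta>: "\<delta> > 0" "\<forall>x\<in>X. \<forall>y\<in>X. d x y \<le> \<delta> \<longrightarrow> \<rho> x y \<le> \<epsilon> / 2"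
      using semimetric_L_tendsto_0_imp_uniform[of X \<rho> d "\<epsilon> / 2"] eq
      unfolding semimetric_equivalent_on_def by auto
    obtain N where N: "\<forall>n\<ge>N. \<forall>m\<ge>N. d (s n) (s m) < \<delta>"
      using Cauchy \<delta>(1) unfolding semimetric_Cauchy_def by blast
    have "\<rho> (s n) (s m) < \<epsilon>" if "n \<ge> N" "m \<ge> N" for n m
    proof -
      have "\<rho> (s n) (s m) \<le> \<epsilon> / 2"
        using N \<delta>(2) s that by (meson less_imp_le range_subsetD)
      then show ?thesis
        using \<open>0 < \<epsilon>\<close> by simp
    qed
    then show "\<exists>N. \<forall>n\<ge>N. \<forall>m\<ge>N. \<rho> (s n) (s m) < \<epsilon>"
      by blast
  qed
  then obtain x where x: "x \<in> X" "(\<lambda>n. \<rho> (s n) x) \<longlonglongrightarrow> 0"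
    using complete s unfolding semimetric_complete_on_def semimetric_converges_def by blast
  have "(\<lambda>n. d (s n) x) \<longlonglongrightarrow> 0"
  proof (rule LIMSEQ_I)
    fix \<epsilon> :: real
    assume "0 < \<epsilon>"
    then obtain \<delta> where \<delta>: "\<delta> > 0" "\<forall>x\<in>X. \<forall>y\<in>X. \<rho> x y \<le> \<delta> \<longrightarrow> d x y \<le> \<epsilon> / 2"
      using semimetric_L_tendsto_0_imp_uniform[of X d \<rho> "\<epsilon> / 2"] eq
      unfolding semimetric_equivalent_on_def by auto
    obtain N where N: "\<forall>n\<ge>N. \<rho> (s n) x < \<delta>"
      using LIMSEQ_D[OF x(2) \<delta>(1)] by fastforce
    have "norm (d (s n) x - 0) < \<epsilon>" if "n \<ge> N" for n
    proof -
      have "d (s n) x \<le> \<epsilon> / 2"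
        using N \<delta>(2) s x(1) that by (meson less_imp_le range_subsetD)
      moreover have "0 \<le> d (s n) x"
        using d s x(1) unfolding semimetric_on_def by auto
      ultimately show ?thesis
        using \<open>0 < \<epsilon>\<close> by simp
    qed
    then show "\<exists>N. \<forall>n\<ge>N. norm (d (s n) x - 0) < \<epsilon>"
      by blast
  qed
  then show "\<exists>x\<in>X. semimetric_converges d s x"
    using x(1) unfolding semimetric_converges_def by blast
qed

text \<open>
  This is the condition known as regularity of a semimetric space. It is equivalent to asking that
  the diameters of balls of radius \<open>r\<close> tend to \<open>0\<close> uniformly in the centre as \<open>r\<close> tends to \<open>0\<close>.
\<close>

definition regular_on :: "'a set \<Rightarrow> ('a \<Rightarrow> 'a \<Rightarrow> real) \<Rightarrow> bool" where
  "regular_on X d \<longleftrightarrow> (\<forall>\<epsilon>>0. \<exists>\<delta>>0. \<forall>x\<in>X. \<forall>y\<in>X. \<forall>z\<in>X. d x z \<le> \<delta> \<longrightarrow> d y z \<le> \<delta> \<longrightarrow> d x y \<le> \<epsilon>)"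

lemma relaxed_metric_imp_inframetric:
  assumes "relaxed_metric_on c X \<rho>" and "0 \<le> c"
  shows "inframetric_on (2 * c) X \<rho>"
proof -
  have "\<rho> x y \<le> 2 * c * max (\<rho> x z) (\<rho> y z)" if "x \<in> X" "y \<in> X" "z \<in> X" for x y z
  proof -
    have "\<rho> x y \<le> c * (\<rho> x z + \<rho> y z)"
      using assms(1) that unfolding relaxed_metric_on_def by blast
    also have "\<dots> \<le> c * (2 * max (\<rho> x z) (\<rho> y z))"
      using \<open>0 \<le> c\<close> by (intro mult_left_mono) auto
    finally show ?thesis
      by simp
  qed
  then show ?thesis
    using assms(1) unfolding relaxed_metric_on_def inframetric_on_def by blast
qed

text \<open>
  Pass from \<open>d\<close> to \<open>\<rho>\<close>, apply the inframetric inequality there, and return to \<open>d\<close>.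
\<close>

lemma regular_if_equivalent_inframetric:
  assumes infra: "inframetric_on c X \<rho>" and "0 < c"
    and eq: "semimetric_equivalent_on X d \<rho>"
  shows "regular_on X d"
  unfolding regular_on_def
proof (intro allI impI)
  fix \<epsilon> :: real
  assume "0 < \<epsilon>"
  then obtain \<eta> where \<eta>: "\<eta> > 0" "\<forall>x\<in>X. \<forall>y\<in>X. \<rho> x y \<le> \<eta> \<longrightarrow> d x y \<le> \<epsilon>"
    using semimetric_L_tendsto_0_imp_uniform[of X d \<rho> \<epsilon>] eq
    unfolding semimetric_equivalent_on_def by auto
  obtain \<delta> where \<delta>: "\<delta> > 0" "\<forall>x\<in>X. \<forall>y\<in>X. d x y \<le> \<delta> \<longrightarrow> \<rho> x y \<le> \<eta> / c"
    using semimetric_L_tendsto_0_imp_uniform[of X \<rho> d "\<eta> / c"] eq \<eta>(1) \<open>0 < c\<close>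
    unfolding semimetric_equivalent_on_def by auto
  have "d x y \<le> \<epsilon>" if "x \<in> X" "y \<in> X" "z \<in> X" "d x z \<le> \<delta>" "d y z \<le> \<delta>" for x y z
  proof -
    have "\<rho> x y \<le> c * max (\<rho> x z) (\<rho> y z)"
      using infra that unfolding inframetric_on_def by blast
    also have "\<dots> \<le> c * (\<eta> / c)"
      using \<delta>(2) that \<open>0 < c\<close> by (intro mult_left_mono) auto
    finally show ?thesis
      using \<eta>(2) that \<open>0 < c\<close> by simp
  qed
  then show "\<exists>\<delta>>0. \<forall>x\<in>X. \<forall>y\<in>X. \<forall>z\<in>X. d x z \<le> \<delta> \<longrightarrow> d y z \<le> \<delta> \<longrightarrow> d x y \<le> \<epsilon>"
    using \<delta>(1) by blast
qed

section \<open>Comparison functions and iterated contractions\<close>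

lemma comparison_function_funpow_nonneg:
  assumes "comparison_function \<phi>" and "0 \<le> t"
  shows "0 \<le> (\<phi> ^^ n) t"
proof (induction n)
  case (Suc n)
  then show ?case
    using assms(1) unfolding comparison_function_def by (simp add: Pi_iff)
qed (use assms(2) in simp)

lemma comparison_function_mono:
  assumes "comparison_function \<phi>" and "0 \<le> s" and "s \<le> t"
  shows "\<phi> s \<le> \<phi> t"
  using assms mono_onD[of "{0..}" \<phi> s t] unfolding comparison_function_def by (meson atLeast_iff order_trans)

lemma comparison_function_funpow_mono:
  assumes "comparison_function \<phi>" and "0 \<le> s" and "s \<le> t"
  shows "(\<phi> ^^ n) s \<le> (\<phi> ^^ n) t"
proof (induction n)
  case (Suc n)
  then show ?case
    using comparison_function_mono[OF assms(1) comparison_function_funpow_nonneg[OF assms(1,2)]] by simp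
qed (use assms in simp)

text \<open>
  If \<open>\<phi> t \<ge> t\<close>, then monotonicity keeps all iterates of \<open>t\<close> above \<open>t\<close>, away from \<open>0\<close>.
\<close>

lemma comparison_function_less:
  assumes "comparison_function \<phi>" and "0 < t"
  shows "\<phi> t < t"
proof (rule ccontr)
  assume "\<not> \<phi> t < t"
  then have le: "t \<le> \<phi> t"
    by simp
  have "t \<le> (\<phi> ^^ n) t" for n
  proof (induction n)
    case (Suc n)
    then have "\<phi> t \<le> \<phi> ((\<phi> ^^ n) t)"
      using assms by (simp add: comparison_function_mono)
    then show ?case
      using le by simp
  qed simp
  moreover have "(\<lambda>n. (\<phi> ^^ n) t) \<longlonglongrightarrow> 0"
    using assms unfolding comparison_function_def by auto
  ultimately have "t \<le> 0"
    by (intro LIMSEQ_le_const) auto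
  then show False
    using \<open>0 < t\<close> by simp
qed

lemma comparison_function_le:
  assumes "comparison_function \<phi>" and "0 \<le> t"
  shows "\<phi> t \<le> t"
proof (cases "t = 0")
  case True
  \<comment> \<open>\<open>\<phi> 0 \<le> \<phi> s < s\<close> for every \<open>s > 0\<close>\<close>
  have "\<phi> 0 \<le> s" if "0 < s" for s
    using comparison_function_mono[OF assms(1), of 0 s] comparison_function_less[OF assms(1) that] that
    by linarith
  then show ?thesis
    using True by (auto intro: field_le_epsilon)
next
  case False
  then show ?thesis
    using comparison_function_less[OF assms(1), of t] assms(2) by simp
qed

lemma contraction_funpow:
  assumes \<phi>: "comparison_function \<phi>" and d: "semimetric_on X d" and T: "contraction_on \<phi> X d T"
    and "x \<in> X" and "y \<in> X"
  shows "(T ^^ n) x \<in> X \<and> (T ^^ n) y \<in> X \<and> d ((T ^^ n) x) ((T ^^ n) y) \<le> (\<phi> ^^ n) (d x y)"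
proof (induction n)
  case 0
  then show ?case
    using assms by simp
next
  case (Suc n)
  let ?x = "(T ^^ n) x" and ?y = "(T ^^ n) y"
  have "d (T ?x) (T ?y) \<le> \<phi> (d ?x ?y)"
    using T Suc unfolding contraction_on_def by blast
  also have "\<dots> \<le> \<phi> ((\<phi> ^^ n) (d x y))"
    using d Suc by (simp add: comparison_function_mono[OF \<phi>] semimetric_on_def)
  finally show ?case
    using T Suc unfolding contraction_on_def by auto
qed

section \<open>The fixed point theorem in complete regular semimetric spaces\<close>

text \<open>
  The tail of the orbit is trapped in the ball of radius \<open>\<epsilon>\<close> around one of its points \<open>x\<^sub>n\<close>. A
  power \<open>T\<^sup>m\<close> sends this ball into a much smaller one around \<open>x\<^sub>n\<^sub>+\<^sub>m\<close>, and \<open>x\<^sub>n\<^sub>+\<^sub>m\<close> is close to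
  \<open>x\<^sub>n\<close>, so \<open>T\<^sup>m\<close> preserves the ball. It remains to start the induction with the first \<open>m\<close> points
  after \<open>x\<^sub>n\<close>.
\<close>

lemma orbit_tail_in_ball:
  assumes \<phi>: "comparison_function \<phi>" and d: "semimetric_on X d" and reg: "regular_on X d"
    and T: "contraction_on \<phi> X d T" and "x \<in> X" and "0 < \<epsilon>"
  shows "\<exists>N. \<forall>p\<ge>N. d ((T ^^ p) x) ((T ^^ N) x) \<le> \<epsilon>"
proof -
  define s where "s n = (T ^^ n) x" for n
  have s: "s n \<in> X" for n
    using contraction_funpow[OF \<phi> d T \<open>x \<in> X\<close> \<open>x \<in> X\<close>] unfolding s_def by blast
  have nonneg: "0 \<le> d (s i) (s j)" for i j
    using d s unfolding semimetric_on_def by blast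
  have shift: "d (s (n + i)) (s (n + j)) \<le> (\<phi> ^^ n) (d (s i) (s j))" for n i j
    using contraction_funpow[OF \<phi> d T s s, of n i j] unfolding s_def by (simp add: funpow_add)
  have iterates: "(\<lambda>n. (\<phi> ^^ n) t) \<longlonglongrightarrow> 0" if "0 \<le> t" for t
    using \<phi> that unfolding comparison_function_def by blast
  have small: "eventually (\<lambda>n. (\<phi> ^^ n) t < r) sequentially" if "0 \<le> t" "0 < r" for t r
    using order_tendstoD(2)[OF iterates[OF that(1)] that(2)] .
  obtain \<delta>0 where \<delta>0: "\<delta>0 > 0"
    "\<forall>x\<in>X. \<forall>y\<in>X. \<forall>z\<in>X. d x z \<le> \<delta>0 \<longrightarrow> d y z \<le> \<delta>0 \<longrightarrow> d x y \<le> \<epsilon>"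
    using reg \<open>0 < \<epsilon>\<close> unfolding regular_on_def by blast
  define \<delta> where "\<delta> = min \<delta>0 \<epsilon>"
  have \<delta>: "0 < \<delta>" "\<delta> \<le> \<delta>0" "\<delta> \<le> \<epsilon>"
    using \<delta>0(1) \<open>0 < \<epsilon>\<close> unfolding \<delta>_def by auto
  have "eventually (\<lambda>m. (\<phi> ^^ m) \<epsilon> < \<delta> \<and> 0 < m) sequentially"
    using small[of \<epsilon> \<delta>] \<open>0 < \<epsilon>\<close> \<delta>(1) eventually_gt_at_top[of 0] by (intro eventually_conj) auto
  then obtain m where m: "(\<phi> ^^ m) \<epsilon> < \<delta>" "0 < m"
    by (auto dest: eventually_happens)
  have "eventually (\<lambda>n. \<forall>j\<in>{..m}. (\<phi> ^^ n) (d (s j) (s 0)) < \<delta>) sequentially"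
    using small[OF nonneg \<delta>(1)] by (intro eventually_ball_finite) auto
  then obtain N where N: "\<And>j. j \<le> m \<Longrightarrow> (\<phi> ^^ N) (d (s j) (s 0)) < \<delta>"
    unfolding eventually_sequentially by (meson atMost_iff order_refl)
  have near: "d (s (N + j)) (s N) \<le> \<delta>" if "j \<le> m" for j
    using shift[of N j 0] N[OF that] by simp
  have "d (s (N + k)) (s N) \<le> \<epsilon>" for k
  proof (induction k rule: less_induct)
    case (less k)
    show ?case
    proof (cases "k \<le> m")
      case True
      then show ?thesis
        using near \<delta>(3) by fastforce
    next
      case False
      define l where "l = k - m"
      have k: "k = m + l" "l < k"
        using False m(2) unfolding l_def by auto
      have "d (s (m + (N + l))) (s (m + N)) \<le> (\<phi> ^^ m) (d (s (N + l)) (s N))"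
        by (rule shift)
      also have "\<dots> \<le> (\<phi> ^^ m) \<epsilon>"
        using less k(2) nonneg by (simp add: comparison_function_funpow_mono[OF \<phi>])
      finally have 1: "d (s (N + k)) (s (N + m)) \<le> \<delta>0"
        using m(1) \<delta>(2) unfolding k(1) by (simp add: algebra_simps)
      have "d (s N) (s (N + m)) = d (s (N + m)) (s N)"
        using d s unfolding semimetric_on_def by blast
      then have 2: "d (s N) (s (N + m)) \<le> \<delta>0"
        using near[of m] \<delta>(2) by simp
      show ?thesis
        using \<delta>0(2) s 1 2 by blast
    qed
  qed
  then have "\<forall>p\<ge>N. d (s p) (s N) \<le> \<epsilon>"
    by (metis le_Suc_ex)
  then show ?thesis
    unfolding s_def by blast
qed

lemma orbit_Cauchy:
  assumes \<phi>: "comparison_function \<phi>" and d: "semimetric_on X d" and reg: "regular_on X d"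
    and T: "contraction_on \<phi> X d T" and "x \<in> X"
  shows "semimetric_Cauchy d (\<lambda>n. (T ^^ n) x)"
  unfolding semimetric_Cauchy_def
proof (intro allI impI)
  fix \<epsilon> :: real
  assume "0 < \<epsilon>"
  then have "0 < \<epsilon> / 2"
    by simp
  then obtain \<delta> where \<delta>: "\<delta> > 0"
    "\<forall>x\<in>X. \<forall>y\<in>X. \<forall>z\<in>X. d x z \<le> \<delta> \<longrightarrow> d y z \<le> \<delta> \<longrightarrow> d x y \<le> \<epsilon> / 2"
    using reg unfolding regular_on_def by blast
  obtain N where N: "\<forall>p\<ge>N. d ((T ^^ p) x) ((T ^^ N) x) \<le> \<delta>"
    using orbit_tail_in_ball[OF assms \<delta>(1)] by blast
  have X: "(T ^^ n) x \<in> X" for n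
    using contraction_funpow[OF \<phi> d T \<open>x \<in> X\<close> \<open>x \<in> X\<close>] by blast
  have "d ((T ^^ n) x) ((T ^^ k) x) < \<epsilon>" if "n \<ge> N" "k \<ge> N" for n k
  proof -
    have "d ((T ^^ n) x) ((T ^^ k) x) \<le> \<epsilon> / 2"
      using \<delta>(2) N X that by blast
    then show ?thesis
      using \<open>0 < \<epsilon>\<close> by simp
  qed
  then show "\<exists>N. \<forall>n\<ge>N. \<forall>m\<ge>N. d ((T ^^ n) x) ((T ^^ m) x) < \<epsilon>"
    by blast
qed

text \<open>
  Since \<open>\<phi> t \<le> t\<close>, the point \<open>x\<^sub>n\<^sub>+\<^sub>1\<close> is at least as close to \<open>T z\<close> as \<open>x\<^sub>n\<close> is to the limit \<open>z\<close>.
  Regularity with \<open>x\<^sub>n\<^sub>+\<^sub>1\<close> as the third point then makes \<open>d z (T z)\<close> arbitrarily small.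
\<close>

lemma fixed_point_if_orbit_converges:
  assumes \<phi>: "comparison_function \<phi>" and d: "semimetric_on X d" and reg: "regular_on X d"
    and T: "contraction_on \<phi> X d T" and "x \<in> X" and "z \<in> X"
    and conv: "semimetric_converges d (\<lambda>n. (T ^^ n) x) z"
  shows "T z = z"
proof -
  have Tz: "T z \<in> X"
    using T \<open>z \<in> X\<close> unfolding contraction_on_def by blast
  have X: "(T ^^ n) x \<in> X" for n
    using contraction_funpow[OF \<phi> d T \<open>x \<in> X\<close> \<open>x \<in> X\<close>] by blast
  have sym: "d a b = d b a" if "a \<in> X" "b \<in> X" for a b
    using d that unfolding semimetric_on_def by blast
  have "d z (T z) \<le> \<epsilon>" if "0 < \<epsilon>" for \<epsilon>
  proof -
    obtain \<delta> where \<delta>: "\<delta> > 0"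
      "\<forall>x\<in>X. \<forall>y\<in>X. \<forall>z\<in>X. d x z \<le> \<delta> \<longrightarrow> d y z \<le> \<delta> \<longrightarrow> d x y \<le> \<epsilon>"
      using reg \<open>0 < \<epsilon>\<close> unfolding regular_on_def by blast
    obtain N where N: "\<forall>n\<ge>N. d ((T ^^ n) x) z < \<delta>"
      using LIMSEQ_D[OF conv[unfolded semimetric_converges_def] \<delta>(1)] by fastforce
    have 1: "d z ((T ^^ Suc N) x) \<le> \<delta>"
      using N[rule_format, of "Suc N"] sym[OF X \<open>z \<in> X\<close>, of "Suc N"] by linarith
    have "d (T ((T ^^ N) x)) (T z) \<le> \<phi> (d ((T ^^ N) x) z)"
      using T X \<open>z \<in> X\<close> unfolding contraction_on_def by blast
    also have "\<dots> \<le> d ((T ^^ N) x) z"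
      using d X \<open>z \<in> X\<close> by (simp add: comparison_function_le[OF \<phi>] semimetric_on_def)
    also have "\<dots> \<le> \<delta>"
      using N by (simp add: less_imp_le)
    finally have "d (T z) ((T ^^ Suc N) x) \<le> \<delta>"
      using sym[OF X Tz, of "Suc N"] by simp
    with 1 show ?thesis
      using \<delta>(2) X Tz \<open>z \<in> X\<close> by blast
  qed
  then have "d z (T z) \<le> 0"
    by (auto intro: field_le_epsilon)
  moreover have "0 \<le> d z (T z)" "d z (T z) = 0 \<longleftrightarrow> z = T z"
    using d Tz \<open>z \<in> X\<close> unfolding semimetric_on_def by blast+
  ultimately show ?thesis
    by simp
qed

lemma contraction_fixed_point_unique:
  assumes \<phi>: "comparison_function \<phi>" and d: "semimetric_on X d" and T: "contraction_on \<phi> X d T"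
    and "x \<in> X" "T x = x" and "y \<in> X" "T y = y"
  shows "x = y"
proof (rule ccontr)
  assume "x \<noteq> y"
  then have "0 < d x y"
    using d \<open>x \<in> X\<close> \<open>y \<in> X\<close> unfolding semimetric_on_def by (metis less_eq_real_def)
  moreover have "d x y \<le> \<phi> (d x y)"
    using T assms(4-7) unfolding contraction_on_def by metis
  ultimately show False
    using comparison_function_less[OF \<phi>, of "d x y"] by simp
qed

theorem contraction_unique_fixed_point_regular:
  assumes \<phi>: "comparison_function \<phi>" and d: "semimetric_on X d" and reg: "regular_on X d"
    and complete: "semimetric_complete_on X d" and T: "contraction_on \<phi> X d T"
  shows "\<exists>!x. x \<in> X \<and> T x = x"
proof -
  obtain x where x: "x \<in> X"
    using d unfolding semimetric_on_def by auto
  have "range (\<lambda>n. (T ^^ n) x) \<subseteq> X"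
    using contraction_funpow[OF \<phi> d T x x] by blast
  then obtain z where z: "z \<in> X" "semimetric_converges d (\<lambda>n. (T ^^ n) x) z"
    using complete orbit_Cauchy[OF \<phi> d reg T x] unfolding semimetric_complete_on_def by blast
  then have "T z = z"
    using fixed_point_if_orbit_converges[OF \<phi> d reg T x] by blast
  with z(1) show ?thesis
    using contraction_fixed_point_unique[OF \<phi> d T] by blast
qed

section \<open>Semimetrics equivalent to relaxed metrics or inframetrics\<close>

theorem corollary3:
  fixes X :: "'a set" and d :: "'a \<Rightarrow> 'a \<Rightarrow> real" and \<phi> :: "real \<Rightarrow> real"
  assumes "semimetric_on X d"
    and "\<exists>c>0. \<exists>\<rho>. (relaxed_metric_on c X \<rho> \<or> inframetric_on c X \<rho>) \<and>
           semimetric_complete_on X \<rho> \<and> semimetric_equivalent_on X d \<rho>"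
    and "comparison_function \<phi>"
  shows "\<forall>T. contraction_on \<phi> X d T \<longrightarrow> (\<exists>!x. x \<in> X \<and> T x = x)"
proof -
  obtain c \<rho> where c: "0 < c" "relaxed_metric_on c X \<rho> \<or> inframetric_on c X \<rho>"
    and complete: "semimetric_complete_on X \<rho>" and eq: "semimetric_equivalent_on X d \<rho>"
    using assms(2) by blast
  obtain c' where c': "0 < c'" "inframetric_on c' X \<rho>"
    using c relaxed_metric_imp_inframetric[of c X \<rho>] by (metis less_imp_le mult_pos_pos zero_less_numeral)
  have "semimetric_complete_on X d"
    using complete_transfer[OF complete assms(1) eq] .
  moreover have "regular_on X d"
    using regular_if_equivalent_inframetric[OF c'(2,1) eq] .
  ultimately show ?thesis
    using contraction_unique_fixed_point_regular[OF assms(3,1)] by blast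
qed

end
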